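(* Let $p$ be an odd prime, $d\ge 1$ an integer, and $t=\lceil\log_2 p\rceil$. Let $P$ be the probability distribution on $C_p^d$ with $P(e_k)=P(-e_k)=\frac{1}{2d}$ for $k=1,\dots,d$. Let $X_0=0$ and $X_{n+1}=2X_n+g_n$, where the $g_n$ are independent random variables on $C_p^d$ with distribution $P$, and let $P_n$ be the distribution of $X_n$. If $n=4dt(\ln t+\ln d+c)$ for some $c>0$, then $$\|P_n-U\|_{\mathrm{TV}}^2\le 2e^{-c}.$$
   Context: $C_p^d$ is the elementary abelian $p$-group written additively as $\mathbb{F}_p^d$, $e_k$ is the $k$-th unit vector, $U$ is the uniform distribution on $C_p^d$, and $\|P-Q\|_{\mathrm{TV}}=\frac12\sum_{g}|P(g)-Q(g)|$ is the total variation distance. $n$ is a positive integer. *)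

theory Defs
  imports "HOL-Probability.Probability" "Berlekamp_Zassenhaus.Finite_Field"
begin

text \<open>Meant for probability measures with all singletons measurable: if \<open>{g}\<close> is not
  measurable, its \<open>measure\<close> is 0 by convention.\<close>

definition tv_dist :: "'a::finite measure \<Rightarrow> 'a measure \<Rightarrow> real" where
  "tv_dist P Q = (1/2) * (\<Sum>g\<in>UNIV. \<bar>measure P {g} - measure Q {g}\<bar>)"

end

theory Submission
  imports Defs
begin

text \<open>By Cauchy--Schwarz and Plancherel, four times the squared total variation distance is at most the
sum, over the nonzero frequencies \<open>a\<close>, of the squared absolute values of the Fourier coefficients of
the distribution of the walk (\<open>tv_dist_uniform_le_fourier\<close>). Since the walk is a sum of
independent steps scaled by powers of 2, its coefficient at \<open>a\<close> is the product of the coefficients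
of a single step at \<open>a, 2 a, 4 a, ...\<close> (\<open>expectation_vec_char_doubling_walk\<close>), and the squared
coefficient of a step at \<open>b\<close> is at most the exponential of \<open>- 1 / (2 d)\<close> times the sum over the
coordinates of \<open>1 - cos (4 \<pi> b_k / p)\<close> (\<open>mean_cos_squared_le\<close>).

It remains to see how often these cosines are not positive. The angle of the \<open>j\<close>-th doubling of a
coordinate \<open>u\<close> is given by the binary expansion of \<open>u / p\<close> shifted by \<open>j\<close> places, and the cosine is
not positive when the first two digits of the shifted expansion differ. The first \<open>t\<close> digits determine
\<open>u\<close>, and for \<open>u \<noteq> 0\<close> they are not constant. A factor \<open>q\<close> for each digit change therefore
produces, in the sum over all \<open>u \<noteq> 0\<close>, at most \<open>2 ((1 + q)^(t - 1) - 1)\<close>, about \<open>2 t q\<close>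
(\<open>sum_exp_orbit_deficit_le\<close>). It is this count of frequencies by their number of digit changes,
rather than a bound for the worst frequency, that yields a logarithm of \<open>t\<close> and not of \<open>p\<close>.

One block of \<open>t\<close> steps only gives \<open>q = exp (- 1 / (2 d))\<close>, so about \<open>n / t\<close> blocks are used. They
see different frequencies, each \<open>2^t\<close> times the one before, but multiplication by a power of 2 permutes
the nonzero frequencies, and the inequality of arithmetic and geometric means replaces the product of
the blocks by a power of one block (\<open>sum_exp_orbit_average_le\<close>). The sum over frequencies then factors
over the \<open>d\<close> coordinates (\<open>sum_exp_cos_deficit_le\<close>), with \<open>q\<close> of order \<open>exp (- 2 c) / (t d)^2\<close> for the
given \<open>n\<close>, which is small enough (\<open>mixing_bound_numeric\<close>).\<close>

section \<open>Characters of the group\<close>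

definition add_char :: "'p::nontriv mod_ring \<Rightarrow> complex" where
  "add_char u = cis (2 * pi * of_int (to_int_mod_ring u) / CARD('p))"

lemma add_char_0 [simp]: "add_char 0 = 1"
  by (simp add: add_char_def to_int_mod_ring.rep_eq zero_mod_ring.rep_eq)

lemma norm_add_char [simp]: "norm (add_char u) = 1"
  by (simp add: add_char_def)

lemma cis_of_int_mod:
  assumes "m > 0"
  shows "cis (2 * pi * of_int (a mod m) / of_int m) = cis (2 * pi * of_int a / of_int m)"
proof -
  have "2 * pi * of_int a / of_int m
      = 2 * pi * of_int (a mod m) / of_int m + 2 * pi * of_int (a div m)"
  proof -
    have "real_of_int a = of_int (a mod m) + of_int m * of_int (a div m)"
      by (metis mod_mult_div_eq of_int_add of_int_mult)
    then show ?thesis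
      using assms by (simp add: field_simps)
  qed
  then have "cis (2 * pi * of_int a / of_int m)
      = cis (2 * pi * of_int (a mod m) / of_int m) * cis (2 * pi * of_int (a div m))"
    by (simp only: cis_mult)
  also have "cis (2 * pi * of_int (a div m)) = 1"
    by (rule cis_multiple_2pi) simp
  finally show ?thesis by simp
qed

lemma add_char_add:
  fixes u v :: "'p::nontriv mod_ring"
  shows "add_char (u + v) = add_char u * add_char v"
  using cis_of_int_mod[of "int CARD('p)" "to_int_mod_ring u + to_int_mod_ring v"]
  by (simp add: add_char_def to_int_mod_ring_add cis_mult field_simps)

lemma add_char_of_nat_mult: "add_char (of_nat m * u) = add_char u ^ m"
  by (induction m) (simp_all add: add_char_add algebra_simps)

lemma add_char_uminus: "add_char (- u) = cnj (add_char u)"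
proof -
  have "add_char u * add_char (- u) = 1" 
    by (simp flip: add_char_add)
  moreover have "add_char u * cnj (add_char u) = 1"
    by (simp flip: complex_norm_square)
  moreover have "add_char u \<noteq> 0"
    by (metis norm_add_char norm_zero zero_neq_one)
  ultimately show ?thesis
    by (metis mult_left_cancel)
qed

lemma add_char_eq_1_iff: "add_char u = 1 \<longleftrightarrow> u = 0"
  for u :: "'p::nontriv mod_ring"
proof
  assume "add_char u = 1"
  then have "cos (2 * pi * of_int (to_int_mod_ring u) / CARD('p)) = 1"
    by (metis add_char_def cis.simps(1) one_complex.simps(1))
  then obtain k :: int where k: "2 * pi * of_int (to_int_mod_ring u) / CARD('p) = of_int k * 2 * pi"
    by (auto simp: cos_one_2pi_int)
  have P: "0 < int CARD('p)" by simp
  from k have "real_of_int (to_int_mod_ring u) = real_of_int (k * int CARD('p))"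
    by (simp add: field_simps)
  then have eq: "to_int_mod_ring u = k * int CARD('p)"
    by (simp only: of_int_eq_iff)
  have "to_int_mod_ring u \<in> {0..<int CARD('p)}"
    using range_to_int_mod_ring[where ?'a = 'p] by blast
  then have "to_int_mod_ring u = 0"
    using eq by (auto simp: mult_less_cancel_right1 zero_le_mult_iff)
  then show "u = 0"
    by (metis of_int_mod_ring_to_int_mod_ring of_int_0 of_int_of_int_mod_ring)
qed simp

text \<open>The pairing with \<open>a\<close> ranging over the whole space runs through all characters of the
elementary abelian group; it is symmetric in the two arguments.\<close>

definition vec_char :: "'p::nontriv mod_ring ^ 'd \<Rightarrow> 'p mod_ring ^ 'd \<Rightarrow> complex" where
  "vec_char a x = add_char (\<Sum>k\<in>UNIV. a $ k * x $ k)"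

lemma vec_char_commute: "vec_char a x = vec_char x a"
  by (simp add: vec_char_def mult.commute)

lemma vec_char_0 [simp]: "vec_char 0 x = 1" "vec_char a 0 = 1"
  by (simp_all add: vec_char_def)

lemma norm_vec_char [simp]: "norm (vec_char a x) = 1"
  by (simp add: vec_char_def)

lemma vec_char_add_right: "vec_char a (x + y) = vec_char a x * vec_char a y"
  by (simp add: vec_char_def distrib_left sum.distrib add_char_add)

lemma vec_char_add_left: "vec_char (a + b) x = vec_char a x * vec_char b x"
  by (simp add: vec_char_def distrib_right sum.distrib add_char_add)

lemma vec_char_uminus_right: "vec_char a (- x) = cnj (vec_char a x)"
  by (simp add: vec_char_def sum_negf add_char_uminus)

text \<open>Doubling is self-adjoint for the pairing, so a doubling of the walk becomes a doubling of the
frequency.\<close>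

lemma vec_char_scale: "vec_char a (c *s x) = vec_char (c *s a) x"
  by (simp add: vec_char_def vector_scalar_mult_def algebra_simps)

lemma vec_char_axis: "vec_char a (axis k 1) = add_char (a $ k)"
proof -
  have "(\<Sum>i\<in>UNIV. a $ i * axis k 1 $ i) = (\<Sum>i\<in>UNIV. if i = k then a $ i else 0)"
    by (rule sum.cong) (auto simp: axis_def)
  then show ?thesis by (simp add: vec_char_def)
qed

text \<open>If \<open>x \<noteq> 0\<close>, some character \<open>b\<close> is nontrivial at \<open>x\<close>, and translating the summation variable by
\<open>b\<close> multiplies the sum by a number other than 1.\<close>

lemma sum_vec_char:
  fixes x :: "'p::nontriv mod_ring ^ 'd::finite"
  shows "(\<Sum>a\<in>UNIV. vec_char a x) = (if x = 0 then of_nat CARD('p mod_ring ^ 'd) else 0)"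
proof (cases "x = 0")
  case False
  then obtain k where k: "x $ k \<noteq> 0"
    by (auto simp: vec_eq_iff)
  define b :: "'p mod_ring ^ 'd" where "b = axis k 1"
  have b: "vec_char b x \<noteq> 1"
    using k by (simp add: b_def vec_char_commute[of _ x] vec_char_axis add_char_eq_1_iff)
  have "(\<Sum>a\<in>UNIV. vec_char a x) = (\<Sum>a\<in>UNIV. vec_char (b + a) x)"
    by (rule sum.reindex_bij_betw[symmetric]) (rule bij_betw_byWitness[where f' = "\<lambda>a. a - b"], auto)
  also have "\<dots> = vec_char b x * (\<Sum>a\<in>UNIV. vec_char a x)"
    by (simp add: vec_char_add_left sum_distrib_left)
  finally show ?thesis
    using b False by simp
qed (simp del: CARD_vec)

section \<open>The upper bound lemma\<close>

definition fourier :: "('p::nontriv mod_ring ^ 'd::finite \<Rightarrow> real) \<Rightarrow> 'p mod_ring ^ 'd \<Rightarrow> complex" where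
  "fourier f a = (\<Sum>x\<in>UNIV. of_real (f x) * vec_char a x)"

lemma plancherel:
  fixes f :: "'p::nontriv mod_ring ^ 'd::finite \<Rightarrow> real"
  shows "(\<Sum>a\<in>UNIV. (norm (fourier f a))\<^sup>2) = real CARD('p mod_ring ^ 'd) * (\<Sum>x\<in>UNIV. (f x)\<^sup>2)"
proof -
  have "complex_of_real (\<Sum>a\<in>UNIV. (norm (fourier f a))\<^sup>2)
      = (\<Sum>a\<in>UNIV. fourier f a * cnj (fourier f a))"
    by (simp add: complex_norm_square del: of_real_power)
  also have "\<dots> = (\<Sum>a\<in>UNIV. \<Sum>x\<in>UNIV. \<Sum>y\<in>UNIV. of_real (f x) * of_real (f y) * vec_char a (x - y))"
    by (simp add: fourier_def sum_product diff_conv_add_uminus vec_char_add_right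
        vec_char_uminus_right mult_ac del: add_uminus_conv_diff)
  also have "\<dots> = (\<Sum>x\<in>UNIV. \<Sum>y\<in>UNIV. \<Sum>a\<in>UNIV. of_real (f x) * of_real (f y) * vec_char a (x - y))"
    by (subst sum.swap, rule sum.cong[OF refl], rule sum.swap)
  also have "\<dots> = (\<Sum>x\<in>UNIV. \<Sum>y\<in>UNIV. of_real (f x) * of_real (f y) *
      (if x = y then of_nat CARD('p mod_ring ^ 'd) else 0))"
    by (simp add: sum_vec_char flip: sum_distrib_left del: CARD_vec)
  also have "\<dots> = (\<Sum>x\<in>UNIV. of_real ((f x)\<^sup>2) * of_nat CARD('p mod_ring ^ 'd))"
    by (simp add: if_distrib power2_eq_square cong: if_cong del: CARD_vec)
  also have "\<dots> = of_real (real CARD('p mod_ring ^ 'd) * (\<Sum>x\<in>UNIV. (f x)\<^sup>2))"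
    by (simp add: sum_distrib_left mult.commute del: CARD_vec)
  finally show ?thesis
    by (simp only: of_real_eq_iff)
qed

text \<open>Cauchy--Schwarz turns the L1 distance into an L2 distance at the cost of the group
order, which is exactly the factor that Plancherel absorbs. Subtracting the uniform distribution
kills the frequency 0 and leaves every other Fourier coefficient unchanged.\<close>

lemma tv_dist_uniform_le_fourier:
  fixes Q :: "('p::nontriv mod_ring ^ 'd::finite) measure"
  assumes Q: "prob_space Q" "sets Q = UNIV"
  shows "4 * (tv_dist Q (measure_pmf (pmf_of_set UNIV)))\<^sup>2
    \<le> (\<Sum>a\<in>-{0}. (norm (fourier (\<lambda>x. measure Q {x}) a))\<^sup>2)"
proof -
  let ?N = "CARD('p mod_ring ^ 'd)"
  define D where "D x = measure Q {x} - 1 / ?N" for x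
  have N: "real ?N > 0"
    by (simp del: CARD_vec add: card_gt_0_iff)
  interpret prob_space Q by (rule Q)
  have "space Q = UNIV"
    using Q(2) sets.sets_into_space[of UNIV Q] by auto
  then have total: "(\<Sum>x\<in>UNIV. measure Q {x}) = 1"
    using prob_space finite_measure_eq_sum_singleton[of UNIV] Q(2) by simp
  have D0: "fourier D 0 = 0"
    using N by (simp add: fourier_def D_def sum_subtractf total del: CARD_vec
        flip: of_real_sum)
  have Da: "fourier D a = fourier (\<lambda>x. measure Q {x}) a" if "a \<noteq> 0" for a
    using sum_vec_char[of a] that
    by (simp add: fourier_def D_def left_diff_distrib sum_subtractf vec_char_commute[of a]
        flip: sum_distrib_left sum_divide_distrib del: CARD_vec)
  have tv: "2 * tv_dist Q (measure_pmf (pmf_of_set UNIV)) = (\<Sum>x\<in>UNIV. \<bar>D x\<bar>)"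
    by (simp add: tv_dist_def D_def pmf_of_set measure_pmf_single del: CARD_vec)
  have "4 * (tv_dist Q (measure_pmf (pmf_of_set UNIV)))\<^sup>2 = (\<Sum>x\<in>UNIV. \<bar>D x\<bar>)\<^sup>2"
    by (simp flip: tv add: power_mult_distrib)
  also have "\<dots> \<le> ?N * (\<Sum>x\<in>UNIV. (D x)\<^sup>2)"
    using sum_squared_le_sum_of_squares[of "\<lambda>x. \<bar>D x\<bar>" UNIV]
    by (simp add: mult.commute del: CARD_vec)
  also have "\<dots> = (\<Sum>a\<in>UNIV. (norm (fourier D a))\<^sup>2)"
    by (rule plancherel[symmetric])
  also have "\<dots> = (\<Sum>a\<in>-{0}. (norm (fourier D a))\<^sup>2)"
    by (rule sum.mono_neutral_right) (auto simp: D0)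
  also have "\<dots> = (\<Sum>a\<in>-{0}. (norm (fourier (\<lambda>x. measure Q {x}) a))\<^sup>2)"
    by (rule sum.cong) (simp_all add: Da)
  finally show ?thesis .
qed

section \<open>Counting changes between adjacent binary digits\<close>

text \<open>Residue 1 or 2 modulo 4 means that the binary expansion ends in 01 or 10.\<close>

definition digit_change :: "nat \<Rightarrow> bool" where
  "digit_change v \<longleftrightarrow> v mod 4 \<in> {1, 2}"

text \<open>The generating monomial of the number of changes among the lowest \<open>m + 1\<close> binary digits.\<close>

definition change_weight :: "real \<Rightarrow> nat \<Rightarrow> nat \<Rightarrow> real" where
  "change_weight q m v = (\<Prod>j<m. if digit_change (v div 2 ^ j) then q else 1)"

lemma change_weight_Suc:
  "change_weight q (Suc m) v = (if digit_change v then q else 1) * change_weight q m (v div 2)"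
  by (simp add: change_weight_def prod.lessThan_Suc_shift div_mult2_eq del: prod.lessThan_Suc)

text \<open>Reading a string of \<open>m + 1\<close> digits from the top, the first digit is free, and each later digit
either repeats its predecessor (factor 1) or changes it (factor \<open>q\<close>). The induction removes the last
digit: exactly one of \<open>2 * v\<close> and \<open>2 * v + 1\<close> ends in a change.\<close>

lemma sum_change_weight: "(\<Sum>v<2 ^ Suc m. change_weight q m v) = 2 * (1 + q) ^ m"
proof (induction m)
  case 0
  then show ?case by (simp add: change_weight_def)
next
  case (Suc m)
  have pair: "change_weight q (Suc m) (2 * v) + change_weight q (Suc m) (2 * v + 1)
      = (1 + q) * change_weight q m v" for v
  proof (cases "even v")
    case True
    then have "\<not> digit_change (2 * v)" "digit_change (2 * v + 1)"
      unfolding digit_change_def by (simp; presburger)+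
    then show ?thesis by (simp add: change_weight_Suc algebra_simps)
  next
    case False
    then have "digit_change (2 * v)" "\<not> digit_change (2 * v + 1)"
      unfolding digit_change_def by (simp; presburger)+
    then show ?thesis by (simp add: change_weight_Suc algebra_simps)
  qed
  have "(\<Sum>v<2 ^ Suc (Suc m). change_weight q (Suc m) v)
      = (\<Sum>v<2 ^ Suc m. \<Sum>w = v * 2..<v * 2 + 2. change_weight q (Suc m) w)"
    by (subst sum.nat_group) (simp add: mult.commute)
  also have "\<dots> = (\<Sum>v<2 ^ Suc m. (1 + q) * change_weight q m v)"
  proof (rule sum.cong[OF refl])
    fix v :: nat
    have "{v * 2..<v * 2 + 2} = {2 * v, 2 * v + 1}" by auto
    then show "(\<Sum>w = v * 2..<v * 2 + 2. change_weight q (Suc m) w) = (1 + q) * change_weight q m v"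
      using pair[of v] by simp
  qed
  also have "\<dots> = (1 + q) * (2 * (1 + q) ^ m)"
    by (simp only: Suc.IH flip: sum_distrib_left)
  also have "\<dots> = 2 * (1 + q) ^ Suc m"
    by simp
  finally show ?case .
qed

lemma change_weight_0: "change_weight q m 0 = 1"
  by (simp add: change_weight_def digit_change_def)

lemma change_weight_all_ones: "change_weight q m (2 ^ Suc m - 1) = 1"
proof (induction m)
  case (Suc m)
  have "\<not> digit_change (2 ^ Suc (Suc m) - 1)"
  proof -
    have "(2::nat) ^ Suc (Suc m) - 1 = 4 * (2 ^ m - 1) + 3"
      by (simp add: algebra_simps)
    then show ?thesis by (simp only: digit_change_def) simp
  qed
  moreover have "(2 ^ Suc (Suc m) - 1) div 2 = (2 ^ Suc m - 1 :: nat)"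
    by simp
  ultimately show ?case
    using Suc.IH by (simp only: change_weight_Suc) simp
qed (simp add: change_weight_def)

text \<open>The two constant strings are the only ones without a change; removing them leaves a sum that
tends to 0 with \<open>q\<close>, which is what makes the final estimate small.\<close>

lemma sum_change_weight_nonconstant:
  assumes "m \<ge> 1"
  shows "(\<Sum>v\<in>{1..<2 ^ Suc m - 1}. change_weight q m v) = 2 * (1 + q) ^ m - 2"
proof -
  have "(2::nat) \<le> 2 ^ m"
    using assms by (metis power_increasing power_one_right one_le_numeral)
  then have "{..<2 ^ Suc m :: nat} = insert 0 (insert (2 ^ Suc m - 1) {1..<2 ^ Suc m - 1})"
    and "(0::nat) \<noteq> 2 ^ Suc m - 1"
    by auto
  then have "(\<Sum>v<2 ^ Suc m. change_weight q m v)
      = change_weight q m 0 + (change_weight q m (2 ^ Suc m - 1)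
          + (\<Sum>v\<in>{1..<2 ^ Suc m - 1}. change_weight q m v))"
    by (simp del: power_Suc)
  then show ?thesis
    by (simp only: sum_change_weight change_weight_0 change_weight_all_ones)
qed

lemma change_weight_nonneg: "q \<ge> 0 \<Longrightarrow> change_weight q m v \<ge> 0"
  unfolding change_weight_def by (rule prod_nonneg) simp

section \<open>One coordinate along its orbit under doubling\<close>

definition residue :: "'p::nontriv mod_ring \<Rightarrow> nat" where
  "residue u = nat (to_int_mod_ring u)"

lemma residue_less: "residue u < CARD('p)" for u :: "'p::nontriv mod_ring"
proof -
  have "to_int_mod_ring u \<in> {0..<int CARD('p)}"
    using range_to_int_mod_ring[where ?'a = 'p] by blast
  then show ?thesis by (auto simp: residue_def)
qed

lemma int_residue: "int (residue u) = to_int_mod_ring u" for u :: "'p::nontriv mod_ring"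
proof -
  have "to_int_mod_ring u \<in> {0..<int CARD('p)}"
    using range_to_int_mod_ring[where ?'a = 'p] by blast
  then show ?thesis by (auto simp: residue_def)
qed

lemma inj_residue: "inj (residue :: 'p::nontriv mod_ring \<Rightarrow> nat)"
  by (rule injI) (metis int_residue of_int_mod_ring_to_int_mod_ring)

lemma residue_eq_0_iff: "residue u = 0 \<longleftrightarrow> u = 0"
proof -
  have "residue (0 :: 'a mod_ring) = 0"
    by (simp add: residue_def to_int_mod_ring.rep_eq zero_mod_ring.rep_eq)
  then show ?thesis
    by (metis inj_residue injD)
qed

text \<open>After \<open>j\<close> doublings the angle is read off from the binary expansion of \<open>residue u / p\<close>, shifted
by \<open>j\<close> digits.\<close>

lemma add_char_pow2_mult:
  "add_char (2 ^ j * u) = cis (2 * pi * (2 ^ j * real (residue u) / CARD('p)))"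
  for u :: "'p::nontriv mod_ring"
proof -
  have "add_char (2 ^ j * u) = add_char u ^ (2 ^ j)"
    using add_char_of_nat_mult[of "2 ^ j" u] by simp
  then show ?thesis
    by (simp add: add_char_def Complex.DeMoivre mult_ac flip: int_residue)
qed

lemma cos_nonpos_middle_half:
  assumes "real_of_int k + 1 / 4 \<le> x" "x \<le> of_int k + 3 / 4"
  shows "cos (2 * pi * x) \<le> 0"
proof -
  define y where "y = 2 * pi * (x - of_int k) - pi"
  have "2 * pi * (1 / 4) \<le> 2 * pi * (x - of_int k)" "2 * pi * (x - of_int k) \<le> 2 * pi * (3 / 4)"
    using assms by (intro mult_left_mono; simp)+
  then have "cos y \<ge> 0"
    unfolding y_def by (intro cos_ge_zero; linarith)
  moreover have "2 * pi * x = y + pi + 2 * pi * of_int k"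
    by (simp add: y_def algebra_simps)
  then have "cos (2 * pi * x) = - cos y"
    by (simp add: cos_add[of "y + pi"])
  ultimately show ?thesis by simp
qed

text \<open>The digits \<open>j + 1\<close> and \<open>j + 2\<close> after the binary point of \<open>x / p\<close> differ iff the fractional part of
\<open>2 ^ j * x / p\<close> lies in the middle half of the unit interval, where the cosine is not positive.\<close>

lemma cos_nonpos_digit_change:
  assumes "p > 0" "digit_change (2 ^ (j + 2) * x div p)"
  shows "cos (2 * pi * (2 ^ j * real x / real p)) \<le> 0"
proof -
  define s where "s = 2 ^ (j + 2) * x div p"
  define k where "k = s div 4"
  have "s = 4 * k + s mod 4" by (simp add: k_def)
  then have s: "4 * k + 1 \<le> s" "s + 1 \<le> 4 * k + 3"
    using assms(2) unfolding digit_change_def s_def by auto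
  have "s * p \<le> 2 ^ (j + 2) * x"
    by (simp add: s_def)
  then have "(4 * k + 1) * p \<le> 2 ^ (j + 2) * x"
    using mult_right_mono[OF s(1), of p] by linarith
  then have "real ((4 * k + 1) * p) \<le> real (2 ^ (j + 2) * x)"
    by (simp only: of_nat_le_iff)
  then have lo: "(4 * real k + 1) * real p \<le> 4 * (2 ^ j * real x)"
    by (simp add: algebra_simps)
  have "2 ^ (j + 2) * x < (s + 1) * p"
    using assms(1) by (simp add: s_def dividend_less_times_div mult.commute)
  then have "2 ^ (j + 2) * x \<le> (4 * k + 3) * p"
    using mult_right_mono[OF s(2), of p] by linarith
  then have "real (2 ^ (j + 2) * x) \<le> real ((4 * k + 3) * p)"
    by (simp only: of_nat_le_iff)
  then have hi: "4 * (2 ^ j * real x) \<le> (4 * real k + 3) * real p"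
    by (simp add: algebra_simps)
  show ?thesis
    by (rule cos_nonpos_middle_half[of "int k"])
      (use lo hi assms(1) in \<open>simp_all add: field_simps\<close>)
qed

definition orbit_deficit :: "nat \<Rightarrow> 'p::nontriv mod_ring \<Rightarrow> real" where
  "orbit_deficit t u = (\<Sum>j<t. 1 - Re (add_char (2 ^ j * u)))"

lemma Re_add_char_le_1: "Re (add_char u) \<le> 1"
  using complex_Re_le_cmod[of "add_char u"] by simp

text \<open>Each digit change among the first \<open>m + 1\<close> digits of \<open>residue u / p\<close> contributes at least 1 to the
deficit. The digit string is the integer part of \<open>2 ^ Suc m * residue u / p\<close>, whose digits are indexed
from the low end, hence the reversal of the index.\<close>

lemma exp_orbit_deficit_le_change_weight:
  fixes u :: "'p::nontriv mod_ring"
  assumes "A \<ge> 0"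
  shows "exp (- A * orbit_deficit (Suc m) u)
    \<le> change_weight (exp (- A)) m (2 ^ Suc m * residue u div CARD('p))"
proof -
  let ?v = "2 ^ Suc m * residue u div CARD('p)"
  have digit: "exp (- A * (1 - Re (add_char (2 ^ j * u))))
      \<le> (if digit_change (?v div 2 ^ (m - Suc j)) then exp (- A) else 1)" if "j < m" for j
  proof -
    have split: "Suc m = (j + 2) + (m - Suc j)" using that by simp
    have "?v div 2 ^ (m - Suc j)
        = 2 ^ (j + 2) * residue u * 2 ^ (m - Suc j) div (CARD('p) * 2 ^ (m - Suc j))"
      by (subst split) (simp only: power_add div_mult2_eq mult_ac)
    also have "\<dots> = 2 ^ (j + 2) * residue u div CARD('p)"
      by (rule div_mult_mult2) simp
    finally have v: "?v div 2 ^ (m - Suc j) = 2 ^ (j + 2) * residue u div CARD('p)" .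
    have "Re (add_char (2 ^ j * u)) \<le> 0"
      if "digit_change (2 ^ (j + 2) * residue u div CARD('p))"
      using cos_nonpos_digit_change[OF _ that] by (simp add: add_char_pow2_mult)
    then show ?thesis
      unfolding v using assms Re_add_char_le_1[of "2 ^ j * u"]
      by (auto intro: mult_left_mono[of 1 _ A, simplified])
  qed
  have "orbit_deficit m u \<le> orbit_deficit (Suc m) u"
    using Re_add_char_le_1 by (simp add: orbit_deficit_def)
  then have "exp (- A * orbit_deficit (Suc m) u) \<le> exp (- A * orbit_deficit m u)"
    using assms by (simp add: mult_left_mono)
  also have "\<dots> = (\<Prod>j<m. exp (- A * (1 - Re (add_char (2 ^ j * u)))))"
    by (simp add: orbit_deficit_def sum_distrib_left exp_sum)
  also have "\<dots> \<le> (\<Prod>j<m. if digit_change (?v div 2 ^ (m - Suc j)) then exp (- A) else 1)"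
    by (rule prod_mono) (use digit in auto)
  also have "\<dots> = change_weight (exp (- A)) m ?v"
    unfolding change_weight_def
    by (rule prod.nat_diff_reindex[where g = "\<lambda>i. if digit_change (?v div 2 ^ i) then exp (- A) else 1"])
  finally show ?thesis .
qed

text \<open>Distinct multiples of \<open>1 / p\<close> are at least \<open>1 / 2 ^ t\<close> apart, so \<open>t\<close> binary digits separate them.\<close>

lemma inj_on_expansion:
  assumes "p > 0" "p \<le> (2::nat) ^ t"
  shows "inj_on (\<lambda>x. 2 ^ t * x div p) A"
proof -
  have "2 ^ t * x div p < 2 ^ t * y div p" if "x < y" for x y
  proof -
    have "2 ^ t * x + 2 ^ t * 1 \<le> 2 ^ t * y"
      using that by (metis Suc_eq_plus1 Suc_leI distrib_left mult_le_mono2)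
    then have "2 ^ t * x + p \<le> 2 ^ t * y"
      using assms(2) by linarith
    then have "(2 ^ t * x + p) div p \<le> 2 ^ t * y div p"
      by (rule div_le_mono)
    then show ?thesis using assms(1) by simp
  qed
  then show ?thesis
    by (intro inj_onI) (metis less_irrefl_nat linorder_neqE_nat)
qed

text \<open>A number strictly between 0 and 1 with denominator \<open>p\<close> is at distance at least \<open>1 / p > 1 / 2 ^ t\<close>
from both ends, so its first \<open>t\<close> digits are neither all 0 nor all 1.\<close>

lemma expansion_nonconstant:
  assumes "0 < x" "x < p" "p < (2::nat) ^ t"
  shows "2 ^ t * x div p \<in> {1..<2 ^ t - 1}"
proof -
  have "1 * p \<le> 2 ^ t * x"
    using assms by (metis less_imp_le_nat mult.commute mult_le_mono One_nat_def Suc_leI)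
  then have lo: "1 \<le> 2 ^ t * x div p"
    using assms by (simp add: less_eq_div_iff_mult_less_eq)
  have "2 ^ t * x \<le> 2 ^ t * (p - 1)"
    using assms by (intro mult_le_mono2) linarith
  also have "\<dots> = 2 ^ t * p - 2 ^ t"
    by (simp add: algebra_simps)
  also have "\<dots> < (2 ^ t - 1) * p"
  proof -
    have "2 ^ t * 1 \<le> 2 ^ t * p" using assms by (intro mult_le_mono2) linarith
    moreover have "(2 ^ t - 1) * p = 2 ^ t * p - p" by (simp add: diff_mult_distrib)
    ultimately show ?thesis using assms(3) by linarith
  qed
  finally have "2 ^ t * x div p < 2 ^ t - 1"
    using assms by (simp add: div_less_iff_less_mult)
  with lo show ?thesis by simp
qed

text \<open>Digit strings embed the nonzero frequencies into the nonconstant strings of length \<open>t\<close>, so the sum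
over frequencies is at most the generating function of digit changes. The summand 1 is the
frequency 0.\<close>

lemma sum_exp_orbit_deficit_le:
  assumes A: "A \<ge> 0" and t: "CARD('p) < 2 ^ t" "t \<ge> 2"
  shows "(\<Sum>u\<in>(UNIV :: 'p::nontriv mod_ring set). exp (- A * orbit_deficit t u))
    \<le> 1 + 2 * ((1 + exp (- A)) ^ (t - 1) - 1)"
proof -
  obtain m where m: "t = Suc m" "m \<ge> 1"
    using t(2) by (cases t) auto
  define \<phi> where "\<phi> u = 2 ^ Suc m * residue u div CARD('p)" for u :: "'p mod_ring"
  have inj: "inj_on \<phi> (-{0})"
  proof (rule inj_onI)
    fix u v assume "\<phi> u = \<phi> v"
    then have "residue u = residue v"
      unfolding \<phi>_def
      using inj_on_expansion[of "CARD('p)" "Suc m" UNIV] t(1) m(1) 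
      by (simp only: inj_eq) (auto dest: injD)
    then show "u = v"
      using inj_residue by (auto dest: injD)
  qed
  have img: "\<phi> ` (-{0}) \<subseteq> {1..<2 ^ Suc m - 1}"
    using expansion_nonconstant[OF _ residue_less] t(1) m(1) residue_eq_0_iff
    unfolding \<phi>_def by blast
  have "(\<Sum>u\<in>-{0 :: 'p mod_ring}. exp (- A * orbit_deficit t u))
      \<le> (\<Sum>u\<in>-{0}. change_weight (exp (- A)) m (\<phi> u))"
    unfolding m(1) \<phi>_def by (intro sum_mono exp_orbit_deficit_le_change_weight A)
  also have "\<dots> = (\<Sum>v\<in>\<phi> ` (-{0}). change_weight (exp (- A)) m v)"
    by (simp add: sum.reindex[OF inj])
  also have "\<dots> \<le> (\<Sum>v\<in>{1..<2 ^ Suc m - 1}. change_weight (exp (- A)) m v)"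
    by (rule sum_mono2[OF _ img]) (simp_all add: change_weight_nonneg)
  also have "\<dots> = 2 * (1 + exp (- A)) ^ m - 2"
    by (rule sum_change_weight_nonconstant) (fact m)
  finally have "(\<Sum>u\<in>-{0 :: 'p mod_ring}. exp (- A * orbit_deficit t u))
      \<le> 2 * (1 + exp (- A)) ^ m - 2" .
  moreover have "(\<Sum>u\<in>(UNIV :: 'p mod_ring set). exp (- A * orbit_deficit t u))
      = exp (- A * orbit_deficit t (0 :: 'p mod_ring))
        + (\<Sum>u\<in>-{0 :: 'p mod_ring}. exp (- A * orbit_deficit t u))"
    by (simp add: sum.remove[of UNIV "0 :: 'p mod_ring"] Compl_eq_Diff_UNIV)
  ultimately show ?thesis
    by (simp add: m(1) orbit_deficit_def)
qed

section \<open>From one coordinate and one block to the whole walk\<close>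

lemma sum_prod_vec:
  fixes w :: "'a::finite \<Rightarrow> 'b::comm_semiring_1"
  shows "(\<Sum>a\<in>(UNIV :: ('a ^ 'd::finite) set). \<Prod>k\<in>UNIV. w (a $ k)) = (\<Sum>u\<in>UNIV. w u) ^ CARD('d)"
proof -
  have "(\<Sum>u\<in>UNIV. w u) ^ CARD('d) = (\<Prod>k\<in>(UNIV :: 'd set). \<Sum>u\<in>UNIV. w u)"
    by simp
  also have "\<dots> = (\<Sum>h\<in>(UNIV :: ('d \<Rightarrow> 'a) set). \<Prod>k\<in>UNIV. w (h k))"
    by (subst prod_sum_PiE) simp_all
  also have "\<dots> = (\<Sum>a\<in>(UNIV :: ('a ^ 'd) set). \<Prod>k\<in>UNIV. w (a $ k))"
    by (rule sum.reindex_bij_witness[where i = vec_nth and j = vec_lambda])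
      (simp_all add: vec_lambda_inverse)
  finally show ?thesis ..
qed

text \<open>By convexity of the exponential function (the inequality of arithmetic and geometric means) a
product over the maps \<open>\<sigma> b\<close> is at most an average of powers, and each \<open>\<sigma> b\<close> merely permutes the
summation. Thus different blocks of steps, which see different frequencies, may be treated as if
they all saw the same one.\<close>

lemma sum_exp_orbit_average_le:
  fixes y :: "'a \<Rightarrow> real" and \<sigma> :: "'b \<Rightarrow> 'a \<Rightarrow> 'a"
  assumes "finite B" and bij: "\<And>b. b \<in> B \<Longrightarrow> bij_betw (\<sigma> b) S S"
  shows "(\<Sum>a\<in>S. exp (\<Sum>b\<in>B. y (\<sigma> b a))) \<le> (\<Sum>a\<in>S. exp (card B * y a))"
proof (cases "B = {}")
  case False
  then have c: "real (card B) > 0" using assms(1) by (simp add: card_gt_0_iff)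
  have "exp (\<Sum>b\<in>B. y (\<sigma> b a)) \<le> (\<Sum>b\<in>B. 1 / card B * exp (card B * y (\<sigma> b a)))" for a
    using convex_on_sum[OF assms(1) False exp_convex, of "\<lambda>b. 1 / card B" "\<lambda>b. card B * y (\<sigma> b a)"] c
    by simp
  then have "(\<Sum>a\<in>S. exp (\<Sum>b\<in>B. y (\<sigma> b a)))
      \<le> (\<Sum>a\<in>S. \<Sum>b\<in>B. 1 / card B * exp (card B * y (\<sigma> b a)))"
    by (rule sum_mono)
  also have "\<dots> = (\<Sum>b\<in>B. 1 / card B * (\<Sum>a\<in>S. exp (card B * y (\<sigma> b a))))"
    by (subst sum.swap) (simp add: sum_distrib_left)
  also have "\<dots> = (\<Sum>b\<in>B. 1 / card B * (\<Sum>a\<in>S. exp (card B * y a)))"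
    by (rule sum.cong[OF refl], rule arg_cong[where f = "\<lambda>x. _ * x"],
        rule sum.reindex_bij_betw[OF bij])
  also have "\<dots> = (\<Sum>a\<in>S. exp (card B * y a))"
    using c by simp
  finally show ?thesis .
qed simp

text \<open>The analogue of \<open>orbit_deficit\<close> for one step and all coordinates: summed over the doublings of the
frequency, it governs the exponential decay of the Fourier coefficients.\<close>

definition cos_deficit :: "'p::nontriv mod_ring ^ 'd::finite \<Rightarrow> real" where
  "cos_deficit a = (\<Sum>k\<in>UNIV. 1 - Re (add_char (a $ k)))"

lemma cos_deficit_nonneg: "cos_deficit a \<ge> 0"
  unfolding cos_deficit_def by (rule sum_nonneg) (simp add: Re_add_char_le_1)

lemma Re_add_char_squared: "(Re (add_char u))\<^sup>2 = (1 + Re (add_char (2 * u))) / 2"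
proof -
  have "add_char (2 * u) = (add_char u)\<^sup>2"
    using add_char_of_nat_mult[of 2 u] by simp
  moreover have "(Re (add_char u))\<^sup>2 + (Im (add_char u))\<^sup>2 = 1"
    using norm_add_char[of u] by (simp flip: cmod_power2)
  ultimately show ?thesis
    by (simp add: power2_eq_square)
qed

text \<open>The Fourier coefficients of a step are averages of cosines, which are close to \<open>-1\<close> as well as to 1
for some frequencies. Squaring removes the sign: by convexity the square of the mean is at most the
mean of the squares, and \<open>cos\<^sup>2 x = (1 + cos (2 * x)) / 2\<close> leads to the next frequency
\<open>2 *s b\<close> of the doubling orbit.\<close>

lemma mean_cos_squared_le:
  fixes b :: "'p::nontriv mod_ring ^ 'd::finite"
  shows "((\<Sum>k\<in>UNIV. Re (add_char (b $ k))) / CARD('d))\<^sup>2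
    \<le> exp (- (1 / (2 * real CARD('d))) * cos_deficit (2 *s b))"
proof -
  let ?d = "real CARD('d)"
  have d: "?d > 0" by simp
  have "((\<Sum>k\<in>UNIV. Re (add_char (b $ k))) / ?d)\<^sup>2
      \<le> (?d * (\<Sum>k\<in>UNIV. (Re (add_char (b $ k)))\<^sup>2)) / ?d\<^sup>2"
    using sum_squared_le_sum_of_squares[of "\<lambda>k. Re (add_char (b $ k))" UNIV]
    by (simp add: power_divide divide_right_mono mult.commute)
  also have "\<dots> = (\<Sum>k\<in>UNIV. (Re (add_char (b $ k)))\<^sup>2) / ?d"
    by (simp add: power2_eq_square)
  also have "\<dots> = 1 - (1 / (2 * ?d)) * cos_deficit (2 *s b)"
    using d by (simp add: Re_add_char_squared cos_deficit_def sum_subtractf sum.distrib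
        flip: sum_divide_distrib) (simp add: field_simps)
  also have "\<dots> \<le> exp (- (1 / (2 * ?d)) * cos_deficit (2 *s b))"
    using exp_ge_add_one_self[of "- (1 / (2 * ?d)) * cos_deficit (2 *s b)"] by simp
  finally show ?thesis .
qed

lemma two_neq_0_mod_ring:
  assumes "odd CARD('p)"
  shows "(2 :: 'p::prime_card mod_ring) \<noteq> 0"
proof
  assume "(2 :: 'p mod_ring) = 0"
  then have "CARD('p) dvd 2"
    using of_nat_0_mod_ring_dvd[where ?'a = 'p, of 2] by simp
  then have "CARD('p) \<le> 2"
    by (rule dvd_imp_le) simp
  moreover have "CARD('p) > 1"
    by (rule nontriv)
  ultimately show False
    using assms by (metis even_numeral le_antisym Suc_1 Suc_leI)
qed

lemma bij_betw_scale_nonzero: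
  fixes c :: "'p::prime_card mod_ring"
  assumes "c \<noteq> 0"
  shows "bij_betw (\<lambda>a :: 'p mod_ring ^ 'd. c *s a) (-{0}) (-{0})"
  by (rule bij_betw_byWitness[where f' = "\<lambda>a. inverse c *s a"])
    (use assms in \<open>auto simp: vec_eq_iff\<close>)

text \<open>Cut the \<open>n\<close> steps into \<open>n div t\<close> full blocks of length \<open>t\<close>, discarding the rest. Multiplication by a
power of 2 permutes the nonzero frequencies, so by averaging all blocks may be taken equal; then the
sum over all frequencies factors over the coordinates, and removing the frequency 0 subtracts 1.\<close>

lemma sum_exp_cos_deficit_le:
  fixes s :: real and n t :: nat
  assumes s: "s \<ge> 0" and p: "odd CARD('p)" "CARD('p) < 2 ^ t" and t: "t \<ge> 2"
  shows "(\<Sum>a\<in>-{0 :: 'p::prime_card mod_ring ^ 'd::finite}.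
            exp (- s * (\<Sum>j<n. cos_deficit (2 ^ Suc j *s a))))
    \<le> (1 + 2 * ((1 + exp (- (s * (n div t)))) ^ (t - 1) - 1)) ^ CARD('d) - 1"
proof -
  define N where "N = n div t"
  define E :: "'p mod_ring ^ 'd \<Rightarrow> real" where "E a = (\<Sum>k\<in>UNIV. orbit_deficit t (a $ k))" for a
  have E: "E a = (\<Sum>j<t. cos_deficit (2 ^ j *s a))" for a
    unfolding E_def orbit_deficit_def cos_deficit_def
    by (subst sum.swap) simp
  have blocks: "(\<Sum>b<N. E (2 ^ Suc (b * t) *s a)) \<le> (\<Sum>j<n. cos_deficit (2 ^ Suc j *s a))" for a
  proof -
    have "(\<Sum>b<N. E (2 ^ Suc (b * t) *s a))
        = (\<Sum>b<N. \<Sum>j = b * t..<b * t + t. cos_deficit (2 ^ Suc j *s a))"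
    proof (rule sum.cong[OF refl])
      fix b
      have "(\<Sum>j = b * t..<b * t + t. cos_deficit (2 ^ Suc j *s a))
          = (\<Sum>j<t. cos_deficit (2 ^ Suc (j + b * t) *s a))"
        using sum.shift_bounds_nat_ivl[of "\<lambda>j. cos_deficit (2 ^ Suc j *s a)" 0 "b * t" t]
        by (simp add: atLeast0LessThan add.commute)
      then show "E (2 ^ Suc (b * t) *s a)
          = (\<Sum>j = b * t..<b * t + t. cos_deficit (2 ^ Suc j *s a))"
        by (simp add: E vector_smult_assoc power_add mult_ac)
    qed
    also have "\<dots> = (\<Sum>j<N * t. cos_deficit (2 ^ Suc j *s a))"
      by (rule sum.nat_group)
    also have "\<dots> \<le> (\<Sum>j<n. cos_deficit (2 ^ Suc j *s a))"
      by (rule sum_mono2) (auto simp: N_def cos_deficit_nonneg intro: less_le_trans)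
    finally show ?thesis .
  qed
  have "(\<Sum>a\<in>-{0 :: 'p mod_ring ^ 'd}. exp (- s * (\<Sum>j<n. cos_deficit (2 ^ Suc j *s a))))
      \<le> (\<Sum>a\<in>-{0 :: 'p mod_ring ^ 'd}. exp (\<Sum>b<N. - s * E (2 ^ Suc (b * t) *s a)))"
    using mult_left_mono[OF blocks s] by (intro sum_mono) (simp add: sum_negf flip: sum_distrib_left)
  also have "\<dots> \<le> (\<Sum>a\<in>-{0 :: 'p mod_ring ^ 'd}. exp (card {..<N} * (- s * E a)))"
    by (rule sum_exp_orbit_average_le)
      (use two_neq_0_mod_ring[OF p(1)] in \<open>auto intro!: bij_betw_scale_nonzero\<close>)
  also have "\<dots> = (\<Sum>a\<in>-{0 :: 'p mod_ring ^ 'd}. \<Prod>k\<in>UNIV. exp (- (s * N) * orbit_deficit t (a $ k)))"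
    by (simp add: E_def sum_distrib_left mult_ac flip: exp_sum sum_negf)
  also have "\<dots> = (\<Sum>a\<in>(UNIV :: ('p mod_ring ^ 'd) set). \<Prod>k\<in>UNIV. exp (- (s * N) * orbit_deficit t (a $ k))) - 1"
    by (simp add: sum.remove[of UNIV "0 :: 'p mod_ring ^ 'd"] Compl_eq_Diff_UNIV orbit_deficit_def)
  also have "\<dots> = (\<Sum>u\<in>(UNIV :: 'p mod_ring set). exp (- (s * N) * orbit_deficit t u)) ^ CARD('d) - 1"
    by (subst sum_prod_vec[of "\<lambda>u. exp (- (s * N) * orbit_deficit t u)"]) (rule refl)
  also have "\<dots> \<le> (1 + 2 * ((1 + exp (- (s * N))) ^ (t - 1) - 1)) ^ CARD('d) - 1"
    using s p t by (intro diff_right_mono power_mono sum_exp_orbit_deficit_le sum_nonneg) simp_all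
  finally show ?thesis unfolding N_def .
qed

section \<open>Fourier coefficients of the doubling walk\<close>

lemma integral_finite_singletons:
  fixes f :: "'a::finite \<Rightarrow> 'b::{banach, second_countable_topology}"
  assumes "finite_measure Q" "sets Q = UNIV"
  shows "(\<integral>x. f x \<partial>Q) = (\<Sum>x\<in>UNIV. measure Q {x} *\<^sub>R f x)"
proof -
  interpret finite_measure Q by fact
  have sp: "space Q = UNIV"
    using assms(2) sets.sets_into_space[of UNIV Q] by auto
  have fin: "emeasure Q A < \<infinity>" for A
    using emeasure_finite[of A] by (simp only: less_top infinity_ennreal_def)
  have "indicator {y} x *\<^sub>R f y = (if x = y then f y else 0)" for x y
    by (cases "x = y") simp_all
  then have "f x = (\<Sum>y\<in>UNIV. indicator {y} x *\<^sub>R f y)" for x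
    by simp
  then have "(\<integral>x. f x \<partial>Q) = (\<integral>x. (\<Sum>y\<in>UNIV. indicator {y} x *\<^sub>R f y) \<partial>Q)"
    by simp
  also have "\<dots> = (\<Sum>y\<in>UNIV. \<integral>x. indicator {y} x *\<^sub>R f y \<partial>Q)"
    using assms(2) by (intro Bochner_Integration.integral_sum integrable_scaleR_left)
      (simp add: integrable_indicator_iff sp fin[unfolded infinity_ennreal_def])
  also have "\<dots> = (\<Sum>y\<in>UNIV. measure Q {y} *\<^sub>R f y)"
    using assms(2) by (simp add: sp integrable_indicator_iff fin[unfolded infinity_ennreal_def])
  finally show ?thesis .
qed

text \<open>The \<open>2 * CARD('d)\<close> vectors are distinct because \<open>CARD('p)\<close> is odd, so their masses add up to 1 and \<open>P\<close> has no
other atom. Opposite vectors contribute conjugate values.\<close>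

lemma expectation_vec_char_unit_steps:
  fixes P :: "('p::prime_card mod_ring ^ 'd::finite) pmf"
  assumes p: "odd CARD('p)"
    and P: "\<And>k. pmf P (axis k 1) = 1 / (2 * CARD('d))"
           "\<And>k. pmf P (- axis k 1) = 1 / (2 * CARD('d))"
  shows "(\<integral>x. vec_char b x \<partial>measure_pmf P) = of_real ((\<Sum>k\<in>UNIV. Re (add_char (b $ k))) / CARD('d))"
proof -
  let ?e = "\<lambda>k. axis k (1 :: 'p mod_ring) :: 'p mod_ring ^ 'd"
  let ?S = "range ?e" and ?T = "range (\<lambda>k. - ?e k)"
  have inj: "inj ?e" "inj (\<lambda>k. - ?e k)"
    by (auto simp: inj_on_def axis_eq_axis)
  have disj: "?S \<inter> ?T = {}"
  proof (rule ccontr)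
    assume "?S \<inter> ?T \<noteq> {}"
    then obtain k l where kl: "?e k = - ?e l" by auto
    then have "?e k $ k = - ?e l $ k" by simp
    then have "(1 :: 'p mod_ring) = - 1"
      by (auto simp: axis_def split: if_splits)
    then show False
      using two_neq_0_mod_ring[OF p] by (metis one_add_one right_minus)
  qed
  have split: "(\<Sum>x\<in>?S \<union> ?T. h x) = (\<Sum>k\<in>UNIV. h (?e k) + h (- ?e k))"
    for h :: "'p mod_ring ^ 'd \<Rightarrow> 'c::comm_monoid_add"
    by (subst sum.union_disjoint) (use disj in \<open>simp_all add: sum.reindex inj sum.distrib\<close>)
  have mass: "(\<Sum>x\<in>?S \<union> ?T. pmf P x) = 1"
    by (simp add: split P)
  have "(\<Sum>x\<in>-(?S \<union> ?T). pmf P x) = 0"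
    using mass sum_pmf_eq_1[of UNIV P] sum.subset_diff[of "?S \<union> ?T" UNIV "pmf P"]
    by (simp add: Compl_eq_Diff_UNIV)
  then have outside: "pmf P x = 0" if "x \<notin> ?S \<union> ?T" for x
    using that by (subst (asm) sum_nonneg_eq_0_iff) auto
  have "(\<integral>x. vec_char b x \<partial>measure_pmf P) = (\<Sum>x\<in>?S \<union> ?T. pmf P x *\<^sub>R vec_char b x)"
    by (rule integral_measure_pmf) (use outside in \<open>auto simp: set_pmf_iff\<close>)
  also have "\<dots> = (\<Sum>k\<in>UNIV. of_real (1 / (2 * CARD('d))) * (vec_char b (?e k) + vec_char b (- ?e k)))"
    by (simp add: split P scaleR_conv_of_real distrib_left)
  also have "\<dots> = (\<Sum>k\<in>UNIV. of_real (Re (add_char (b $ k)) / CARD('d)))"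
    by (simp add: vec_char_axis vec_char_uminus_right complex_add_cnj)
  also have "\<dots> = of_real ((\<Sum>k\<in>UNIV. Re (add_char (b $ k))) / CARD('d))"
    by (simp add: sum_divide_distrib)
  finally show ?thesis .
qed

text \<open>The walk is a sum of independent terms \<open>2 ^ (n - Suc j) *s g j\<close>; moving the powers of 2 to the
frequency gives a product over the doubling orbit of \<open>a\<close>.\<close>

lemma expectation_vec_char_doubling_walk:
  fixes P :: "('p::nontriv mod_ring ^ 'd::finite) pmf"
    and g X :: "nat \<Rightarrow> 'm \<Rightarrow> 'p mod_ring ^ 'd"
  assumes "prob_space M"
    and indep: "prob_space.indep_vars M (\<lambda>_. count_space UNIV) g UNIV"
    and distr_g: "\<And>i. distr M (count_space UNIV) (g i) = measure_pmf P"
    and X_0: "\<And>\<omega>. \<omega> \<in> space M \<Longrightarrow> X 0 \<omega> = 0"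
    and X_Suc: "\<And>i \<omega>. \<omega> \<in> space M \<Longrightarrow> X (Suc i) \<omega> = 2 *s X i \<omega> + g i \<omega>"
  shows "(\<integral>\<omega>. vec_char a (X n \<omega>) \<partial>M) = (\<Prod>j<n. \<integral>x. vec_char (2 ^ j *s a) x \<partial>measure_pmf P)"
proof -
  interpret prob_space M by fact
  have g [measurable]: "g i \<in> M \<rightarrow>\<^sub>M count_space UNIV" for i
    using indep by (auto simp: indep_vars_def2)
  have prod: "vec_char a (X n \<omega>) = (\<Prod>j<n. vec_char (2 ^ (n - Suc j) *s a) (g j \<omega>))"
    if "\<omega> \<in> space M" for \<omega>
  proof (induction n arbitrary: a)
    case 0
    then show ?case by (simp add: X_0 that)
  next
    case (Suc n)
    have "2 ^ (n - Suc j) *s (2 *s a) = 2 ^ (n - j) *s a" if "j < n" for j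
      using that by (simp add: vector_smult_assoc Suc_diff_Suc flip: power_Suc2)
    then show ?case
      by (simp add: X_Suc that vec_char_add_right vec_char_scale Suc.IH)
  qed
  have "(\<integral>\<omega>. vec_char a (X n \<omega>) \<partial>M)
      = (\<integral>\<omega>. (\<Prod>j<n. vec_char (2 ^ (n - Suc j) *s a) (g j \<omega>)) \<partial>M)"
    by (rule Bochner_Integration.integral_cong) (simp_all add: prod)
  also have "\<dots> = (\<Prod>j<n. \<integral>\<omega>. vec_char (2 ^ (n - Suc j) *s a) (g j \<omega>) \<partial>M)"
  proof (rule indep_vars_lebesgue_integral)
    show "indep_vars (\<lambda>_. borel) (\<lambda>j \<omega>. vec_char (2 ^ (n - Suc j) *s a) (g j \<omega>)) {..<n}"
      by (rule indep_vars_compose2[OF indep_vars_subset[OF indep]]) simp_all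
    show "integrable M (\<lambda>\<omega>. vec_char (2 ^ (n - Suc j) *s a) (g j \<omega>))" for j
      by (rule integrable_const_bound[where B = 1]) simp_all
  qed simp
  also have "\<dots> = (\<Prod>j<n. \<integral>x. vec_char (2 ^ (n - Suc j) *s a) x \<partial>measure_pmf P)"
  proof (rule prod.cong[OF refl])
    fix j
    show "(\<integral>\<omega>. vec_char (2 ^ (n - Suc j) *s a) (g j \<omega>) \<partial>M)
        = (\<integral>x. vec_char (2 ^ (n - Suc j) *s a) x \<partial>measure_pmf P)"
      unfolding distr_g[of j, symmetric] by (rule integral_distr[symmetric]) simp_all
  qed
  also have "\<dots> = (\<Prod>j<n. \<integral>x. vec_char (2 ^ j *s a) x \<partial>measure_pmf P)"
    by (rule prod.nat_diff_reindex)
  finally show ?thesis .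
qed

lemma measurable_doubling_walk:
  fixes g X :: "nat \<Rightarrow> 'm \<Rightarrow> 'p::nontriv mod_ring ^ 'd::finite"
  assumes g: "\<And>i. g i \<in> M \<rightarrow>\<^sub>M count_space UNIV"
    and X_0: "\<And>\<omega>. \<omega> \<in> space M \<Longrightarrow> X 0 \<omega> = 0"
    and X_Suc: "\<And>i \<omega>. \<omega> \<in> space M \<Longrightarrow> X (Suc i) \<omega> = 2 *s X i \<omega> + g i \<omega>"
  shows "X n \<in> M \<rightarrow>\<^sub>M count_space UNIV"
proof (induction n)
  case 0
  then show ?case
    by (subst measurable_cong[where g = "\<lambda>_. 0"]) (simp_all add: X_0)
next
  case (Suc n)
  have "(\<lambda>\<omega>. 2 *s X n \<omega> + g n \<omega>) \<in> M \<rightarrow>\<^sub>M count_space UNIV"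
    by (rule measurable_compose_countable[where f = "\<lambda>x \<omega>. 2 *s x + g n \<omega>", OF _ Suc.IH])
      (rule measurable_compose[OF g], simp)
  then show ?case
    by (subst measurable_cong[OF X_Suc])
qed

section \<open>Mixing of the doubling walk\<close>

text \<open>With \<open>y = exp (- c)\<close>, the hypothesis on \<open>A\<close> gives \<open>exp (- A) \<le> 2 * y\<^sup>2 / (t * d)\<^sup>2\<close>. Together with
\<open>(t - 1) / t\<^sup>2 \<le> 1 / 4\<close> this bounds the left-hand side by \<open>exp (3 * y / 2) - 1\<close>, and that is at
most \<open>8 * y\<close> since \<open>y \<le> 1\<close>. The term \<open>1 / 2\<close> in the hypothesis leaves room for an incomplete
block of steps.\<close>

lemma mixing_bound_numeric:
  fixes t d :: nat and A c :: real
  assumes t: "t \<ge> 2" and d: "d \<ge> 1" and c: "c \<ge> 0"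
    and A: "A \<ge> 2 * (ln t + ln d + c) - 1 / 2"
  shows "(1 + 2 * ((1 + exp (- A)) ^ (t - 1) - 1)) ^ d - 1 \<le> 8 * exp (- c)"
proof -
  define y where "y = exp (- c)"
  define z where "z = real (t - 1) * exp (- A)"
  have y: "0 < y" "y \<le> 1" using c by (simp_all add: y_def)
  have td: "real t \<ge> 2" "real d \<ge> 1" using t d by simp_all
  have exp_le: "exp x \<le> 1 + x + x\<^sup>2" if "0 \<le> x" "x \<le> 1" for x :: real
    using exp_bound[OF that] .
  have half: "exp (1 / 2 :: real) \<le> 2"
    using exp_le[of "1 / 2"] by (simp add: power2_eq_square)
  have "exp (- A) \<le> exp (1 / 2 - (2 * ln t + 2 * ln d + 2 * c))"
    using A by simp
  also have "\<dots> = exp (1 / 2) * y\<^sup>2 / ((real t)\<^sup>2 * (real d)\<^sup>2)"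
  proof -
    have "exp (2 * ln (real t) + 2 * ln (real d) + 2 * c) = (real t)\<^sup>2 * (real d)\<^sup>2 * (exp c)\<^sup>2"
      using td by (simp add: exp_add exp_double)
    then show ?thesis
      by (simp only: exp_diff y_def exp_minus) (simp add: field_simps)
  qed
  also have "\<dots> \<le> 2 * y\<^sup>2 / ((real t)\<^sup>2 * (real d)\<^sup>2)"
    using half by (intro divide_right_mono mult_right_mono) simp_all
  also have "\<dots> \<le> 2 * y / ((real t)\<^sup>2 * real d)"
  proof (rule frac_le)
    show "2 * y\<^sup>2 \<le> 2 * y"
      using y by (simp add: power2_eq_square mult_left_le)
    show "(real t)\<^sup>2 * real d \<le> (real t)\<^sup>2 * (real d)\<^sup>2"
      using td by (intro mult_left_mono) (simp_all add: power2_eq_square)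
  qed (use y td in simp_all)
  finally have q: "exp (- A) \<le> 2 * y / ((real t)\<^sup>2 * real d)" .
  have "z \<le> (real t - 1) * (2 * y / ((real t)\<^sup>2 * real d))"
    using mult_left_mono[OF q, of "real (t - 1)"] t by (simp add: z_def)
  also have "\<dots> = (4 * (real t - 1) / (real t)\<^sup>2) * (y / (2 * real d))"
    using td by (simp add: field_simps)
  also have "\<dots> \<le> 1 * (y / (2 * real d))"
  proof (rule mult_right_mono)
    have "4 * (real t - 1) \<le> (real t)\<^sup>2"
      using zero_le_power2[of "real t - 2"] by (simp add: power2_eq_square algebra_simps)
    then show "4 * (real t - 1) / (real t)\<^sup>2 \<le> 1"
      using td by simp
  qed (use y in simp)
  finally have z: "z \<le> y / (2 * real d)" by simp
  have z0: "0 \<le> z" by (simp add: z_def)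
  have "y / (2 * real d) \<le> 1 / 2"
    using y td by (simp add: field_simps)
  with z have z1: "z \<le> 1 / 2" by linarith
  have "(1 + exp (- A)) ^ (t - 1) \<le> exp (exp (- A)) ^ (t - 1)"
    by (intro power_mono exp_ge_add_one_self) (simp add: add_nonneg_nonneg)
  also have "\<dots> = exp z"
    by (simp add: z_def exp_of_nat_mult)
  also have "\<dots> \<le> 1 + z + z\<^sup>2"
    using z0 z1 by (intro exp_le) auto
  also have "\<dots> \<le> 1 + z + 1 / 2 * z"
    using mult_right_mono[OF z1 z0] by (simp add: power2_eq_square)
  finally have "1 + 2 * ((1 + exp (- A)) ^ (t - 1) - 1) \<le> 1 + 3 * y / 2 / real d"
    using z by (simp add: field_simps)
  also have "\<dots> \<le> exp (3 * y / 2 / real d)"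
    by (rule exp_ge_add_one_self)
  finally have "(1 + 2 * ((1 + exp (- A)) ^ (t - 1) - 1)) ^ d \<le> exp (3 * y / 2 / real d) ^ d"
  proof (rule power_mono)
    have "0 \<le> (1 + exp (- A)) ^ (t - 1) - 1"
      using one_le_power[of "1 + exp (- A)" "t - 1"] by simp
    then show "0 \<le> 1 + 2 * ((1 + exp (- A)) ^ (t - 1) - 1)"
      by (intro add_nonneg_nonneg mult_nonneg_nonneg zero_le_one zero_le_numeral)
  qed
  also have "\<dots> = exp (3 * y / 2)"
    using td by (simp flip: exp_of_nat_mult)
  also have "\<dots> = (exp (3 * y / 4))\<^sup>2"
    by (simp flip: exp_double)
  also have "\<dots> \<le> (1 + 3 * y / 2)\<^sup>2"
  proof (rule power_mono)
    have "(3 * y / 4)\<^sup>2 \<le> 3 * y / 4"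
      using y by (simp add: power2_eq_square mult_left_le)
    then show "exp (3 * y / 4) \<le> 1 + 3 * y / 2"
      using exp_le[of "3 * y / 4"] y by linarith
  qed simp
  also have "\<dots> \<le> 1 + 8 * y"
  proof -
    have "y * y \<le> y" using y by (simp add: mult_left_le)
    then show ?thesis using y by (simp add: power2_eq_square algebra_simps)
  qed
  finally show ?thesis by (simp add: y_def)
qed

theorem corollary8p2:
  fixes p d t n :: nat and c :: real
    and P :: "('p::prime_card mod_ring ^ 'd::finite) pmf"
    and M :: "'m measure"
    and g :: "nat \<Rightarrow> 'm \<Rightarrow> 'p mod_ring ^ 'd"
    and X :: "nat \<Rightarrow> 'm \<Rightarrow> 'p mod_ring ^ 'd"
  assumes p: "p = CARD('p)" "prime p" "odd p"
    and d: "d = CARD('d)" "d \<ge> 1"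
    and t: "int t = \<lceil>log 2 (real p)\<rceil>"
    and P: "\<And>k. pmf P (axis k 1) = 1 / (2 * real d)"
           "\<And>k. pmf P (- axis k 1) = 1 / (2 * real d)"
    and M: "prob_space M"
    and indep: "prob_space.indep_vars M (\<lambda>_. count_space UNIV) g UNIV"
    and distr_g: "\<And>i. distr M (count_space UNIV) (g i) = measure_pmf P"
    and X_0: "\<And>\<omega>. \<omega> \<in> space M \<Longrightarrow> X 0 \<omega> = 0"
    and X_Suc: "\<And>i \<omega>. \<omega> \<in> space M \<Longrightarrow> X (Suc i) \<omega> = 2 *s X i \<omega> + g i \<omega>"
    and n: "n > 0" "real n = 4 * real d * real t * (ln (real t) + ln (real d) + c)"
    and c: "c > 0"
  shows "(tv_dist (distr M (count_space UNIV) (X n))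
            (measure_pmf (pmf_of_set UNIV)))\<^sup>2 \<le> 2 * exp (- c)"
proof -
  interpret prob_space M by (rule M)
  have g: "g i \<in> M \<rightarrow>\<^sub>M count_space UNIV" for i
    using indep by (auto simp: indep_vars_def2)
  have X [measurable]: "X n \<in> M \<rightarrow>\<^sub>M count_space UNIV"
    by (rule measurable_doubling_walk[OF g X_0 X_Suc])
  define Q where "Q = distr M (count_space UNIV) (X n)"
  have Q: "prob_space Q" "sets Q = UNIV"
    by (simp_all add: Q_def prob_space_distr)
  have p3: "p \<ge> 3"
    using p(2,3) prime_ge_2_nat[of p] by (cases "p = 2") auto
  have "log 2 (real p) \<le> real t"
    using t by (metis le_of_int_ceiling of_int_of_nat_eq)
  then have "real p \<le> 2 powr real t"
    using p3 by (simp add: log_le_iff)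
  then have "real p \<le> real (2 ^ t)"
    by (simp add: powr_realpow)
  then have "p \<le> 2 ^ t"
    by (simp only: of_nat_le_iff)
  moreover have t2: "t \<ge> 2"
  proof (rule ccontr)
    assume "\<not> t \<ge> 2"
    then have "(2::nat) ^ t \<le> 2 ^ 1" by (intro power_increasing) auto
    then show False using \<open>p \<le> 2 ^ t\<close> p3 by simp
  qed
  \<comment> \<open>Strict inequality is needed to exclude the digit string of ones.\<close>
  moreover have "p \<noteq> 2 ^ t"
    using p(3) t2 by auto
  ultimately have pt: "CARD('p) < 2 ^ t"
    using p(1) by simp
  have fourier_le: "(norm (fourier (\<lambda>x. measure Q {x}) a))\<^sup>2
      \<le> exp (- (1 / (2 * real d)) * (\<Sum>j<n. cos_deficit (2 ^ Suc j *s a)))" for a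
  proof -
    have "fourier (\<lambda>x. measure Q {x}) a = (\<integral>x. vec_char a x \<partial>Q)"
      using Q by (simp add: fourier_def integral_finite_singletons prob_space.finite_measure
          scaleR_conv_of_real)
    also have "\<dots> = (\<integral>\<omega>. vec_char a (X n \<omega>) \<partial>M)"
      unfolding Q_def by (rule integral_distr) simp_all
    also have "\<dots> = (\<Prod>j<n. \<integral>x. vec_char (2 ^ j *s a) x \<partial>measure_pmf P)"
      by (rule expectation_vec_char_doubling_walk[OF M indep distr_g X_0 X_Suc])
    also have "\<dots> = (\<Prod>j<n. of_real ((\<Sum>k\<in>UNIV. Re (add_char ((2 ^ j *s a) $ k))) / CARD('d)))"
      using p P d by (intro prod.cong refl expectation_vec_char_unit_steps) simp_all
    finally have "(norm (fourier (\<lambda>x. measure Q {x}) a))\<^sup>2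
        = (\<Prod>j<n. ((\<Sum>k\<in>UNIV. Re (add_char ((2 ^ j *s a) $ k))) / CARD('d))\<^sup>2)"
      by (simp only: norm_of_real flip: of_real_prod) (simp only: power2_abs prod_power_distrib)
    also have "\<dots> \<le> (\<Prod>j<n. exp (- (1 / (2 * real d)) * cos_deficit (2 *s (2 ^ j *s a))))"
      unfolding d(1) by (intro prod_mono conjI zero_le_power2 mean_cos_squared_le)
    also have "\<dots> = exp (- (1 / (2 * real d)) * (\<Sum>j<n. cos_deficit (2 ^ Suc j *s a)))"
      by (simp only: exp_sum[symmetric] sum_distrib_left[symmetric] finite_lessThan
          vector_smult_assoc power_Suc)
    finally show ?thesis .
  qed
  define A where "A = 1 / (2 * real d) * real (n div t)"
  have A: "A \<ge> 2 * (ln t + ln d + c) - 1 / 2"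
  proof -
    \<comment> \<open>At most one incomplete block is lost, which costs less than \<open>1 / (2 * d)\<close> in \<open>A\<close>.\<close>
    have "real n = real (n div t) * real t + real (n mod t)"
      by (metis div_mult_mod_eq of_nat_add of_nat_mult)
    moreover have "real (n mod t) < real t"
      using t2 by simp
    ultimately have "real n < (real (n div t) + 1) * real t"
      by (simp add: algebra_simps)
    then have "(4 * real d * (ln t + ln d + c)) * real t < (real (n div t) + 1) * real t"
      by (simp add: n(2) mult_ac)
    then have "4 * real d * (ln t + ln d + c) < real (n div t) + 1"
      using t2 by (simp add: mult_less_cancel_right)
    then have "2 * (ln t + ln d + c) < A + 1 / (2 * real d)"
      using d(2) by (simp add: A_def field_simps)
    moreover have "1 / (2 * real d) \<le> 1 / 2"
      using d(2) by (simp add: field_simps)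
    ultimately show ?thesis by linarith
  qed
  have "4 * (tv_dist Q (measure_pmf (pmf_of_set UNIV)))\<^sup>2
      \<le> (\<Sum>a\<in>-{0}. (norm (fourier (\<lambda>x. measure Q {x}) a))\<^sup>2)"
    by (rule tv_dist_uniform_le_fourier[OF Q])
  also have "\<dots> \<le> (\<Sum>a\<in>-{0 :: 'p mod_ring ^ 'd}.
      exp (- (1 / (2 * real d)) * (\<Sum>j<n. cos_deficit (2 ^ Suc j *s a))))"
    by (rule sum_mono) (rule fourier_le)
  also have "\<dots> \<le> (1 + 2 * ((1 + exp (- A)) ^ (t - 1) - 1)) ^ d - 1"
    unfolding A_def d(1) using p(1,3) pt t2 by (intro sum_exp_cos_deficit_le) simp_all
  also have "\<dots> \<le> 8 * exp (- c)"
    using t2 d(2) c A by (intro mixing_bound_numeric) simp_all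
  finally show ?thesis by (simp add: Q_def)
qed

end
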